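(* Let $m \geq 1$ be an integer and let $G = V_{8m} = \langle a, b : a^{2m} = b^4 = 1,\ ba = a^{-1}b^{-1},\ b^{-1}a = a^{-1}b \rangle$. Then $$M_1(\mathcal{CCC}(G)) = \begin{cases} (2m-2)(2m-3)^2 + 4, & \text{when } m \text{ is even} \\ (2m-1)(2m-2)^2, & \text{when } m \text{ is odd} \end{cases}$$ and $$M_2(\mathcal{CCC}(G)) = \begin{cases} (m-1)(2m-3)^3 + 2, & \text{when } m \text{ is even} \\ \frac{(2m-1)(2m-2)^3}{2}, & \text{when } m \text{ is odd.} \end{cases}$$ Further, $\frac{M_2(\mathcal{CCC}(G))}{|e(\mathcal{CCC}(G))|} \geq \frac{M_1(\mathcal{CCC}(G))}{|v(\mathcal{CCC}(G))|}$, with equality when $m = 1$ and $2$.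
   Context: For a finite group $G$ and $x \in G$, $x^G$ denotes the conjugacy class of $x$ in $G$. The commuting conjugacy class graph $\mathcal{CCC}(G)$ is the simple undirected graph whose vertices are the conjugacy classes of non-central elements of $G$, where two distinct vertices $x^G$ and $y^G$ are adjacent if and only if there exist $x' \in x^G$ and $y' \in y^G$ with $x'y' = y'x'$. For a finite simple graph $\Gamma$ with vertex set $v(\Gamma)$ and edge set $e(\Gamma)$, the first and second Zagreb indices are $M_1(\Gamma) = \sum_{v \in v(\Gamma)} \deg(v)^2$ and $M_2(\Gamma) = \sum_{uv \in e(\Gamma)} \deg(u)\deg(v)$. Convention: if $\Gamma$ has no edges (so $M_1(\Gamma)=M_2(\Gamma)=0$), the quotient $M_2(\Gamma)/|e(\Gamma)|$ is read as $0$. *)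

theory Defs
  imports Complex_Main "HOL-Algebra.Group"
begin

section \<open>Groups given by generators and relations\<close>

text \<open>Words over the generators (all elements of the type \<open>'x\<close>) and their formal inverses.\<close>

datatype 'x letter = Gen 'x | Inv 'x

type_synonym 'x word = "'x letter list"

text \<open>The least congruence on words that contains the free cancellations and the relations
  \<open>R\<close>, where a pair \<open>(u, v)\<close> in \<open>R\<close> stands for the relation \<open>u = v\<close>.\<close>

inductive word_eq :: "('x word \<times> 'x word) set \<Rightarrow> 'x word \<Rightarrow> 'x word \<Rightarrow> bool"
  for R where
  word_eq_refl: "word_eq R u u"
| word_eq_sym: "word_eq R u v \<Longrightarrow> word_eq R v u"
| word_eq_trans: "word_eq R u v \<Longrightarrow> word_eq R v w \<Longrightarrow> word_eq R u w"
| word_eq_append: "word_eq R u u' \<Longrightarrow> word_eq R v v' \<Longrightarrow> word_eq R (u @ v) (u' @ v')"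
| word_eq_Gen_Inv: "word_eq R [Gen x, Inv x] []"
| word_eq_Inv_Gen: "word_eq R [Inv x, Gen x] []"
| word_eq_relation: "(u, v) \<in> R \<Longrightarrow> word_eq R u v"

definition word_class :: "('x word \<times> 'x word) set \<Rightarrow> 'x word \<Rightarrow> 'x word set" where
  "word_class R u = {v. word_eq R u v}"

definition presented_group :: "('x word \<times> 'x word) set \<Rightarrow> 'x word set monoid" where
  "presented_group R =
     \<lparr>carrier = range (word_class R),
      mult = (\<lambda>X Y. {w. \<exists>u\<in>X. \<exists>v\<in>Y. word_eq R (u @ v) w}),
      one = word_class R []\<rparr>"

lemma word_class_eq_iff: "word_class R u = word_class R v \<longleftrightarrow> word_eq R u v"
  unfolding word_class_def by (blast intro: word_eq_refl word_eq_sym word_eq_trans)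

lemma carrier_presented_group: "carrier (presented_group R) = range (word_class R)"
  by (simp add: presented_group_def)

lemma one_presented_group: "\<one>\<^bsub>presented_group R\<^esub> = word_class R []"
  by (simp add: presented_group_def)

lemma mult_presented_group:
  "word_class R u \<otimes>\<^bsub>presented_group R\<^esub> word_class R v = word_class R (u @ v)"
  unfolding presented_group_def word_class_def
  by (auto intro: word_eq_refl word_eq_trans word_eq_append)

fun inv_letter :: "'x letter \<Rightarrow> 'x letter" where
  "inv_letter (Gen x) = Inv x"
| "inv_letter (Inv x) = Gen x"

lemma word_eq_inv_left: "word_eq R (rev (map inv_letter u) @ u) []"
proof (induction u)
  case Nil
  show ?case by (simp add: word_eq_refl)
next
  case (Cons l u)
  have "word_eq R [inv_letter l, l] []"
    by (cases l) (auto intro: word_eq_Gen_Inv word_eq_Inv_Gen)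
  then have "word_eq R (rev (map inv_letter u) @ [inv_letter l, l] @ u)
      (rev (map inv_letter u) @ [] @ u)"
    by (intro word_eq_append word_eq_refl)
  with Cons show ?case by (auto intro: word_eq_trans)
qed

lemma group_presented_group: "group (presented_group R)"
proof (rule groupI)
  fix X assume "X \<in> carrier (presented_group R)"
  then obtain u where X: "X = word_class R u"
    by (auto simp: carrier_presented_group)
  have "word_class R (rev (map inv_letter u)) \<otimes>\<^bsub>presented_group R\<^esub> X = \<one>\<^bsub>presented_group R\<^esub>"
    by (simp add: X mult_presented_group one_presented_group word_class_eq_iff word_eq_inv_left)
  then show "\<exists>Y\<in>carrier (presented_group R). Y \<otimes>\<^bsub>presented_group R\<^esub> X = \<one>\<^bsub>presented_group R\<^esub>"
    by (auto simp: carrier_presented_group)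
qed (auto simp: carrier_presented_group one_presented_group mult_presented_group)

datatype generator = a | b

definition V8m_relations :: "nat \<Rightarrow> (generator word \<times> generator word) set" where
  "V8m_relations m =
     {(replicate (2 * m) (Gen a), []),
      (replicate 4 (Gen b), []),
      ([Gen b, Gen a], [Inv a, Inv b]),
      ([Inv b, Gen a], [Inv a, Gen b])}"

definition V8m :: "nat \<Rightarrow> generator word set monoid" where
  "V8m m = presented_group (V8m_relations m)"

hide_const (open) a b


section \<open>The commuting conjugacy class graph\<close>

text \<open>A simple graph is a pair of a vertex set and a set of edges, each edge being a
  two-element set of vertices.\<close>

type_synonym 'v sgraph = "'v set \<times> 'v set set"

abbreviation verts :: "'v sgraph \<Rightarrow> 'v set" where "verts \<equiv> fst"
abbreviation edges :: "'v sgraph \<Rightarrow> 'v set set" where "edges \<equiv> snd"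

definition degree :: "'v sgraph \<Rightarrow> 'v \<Rightarrow> nat" where
  "degree \<Gamma> v = card {e \<in> edges \<Gamma>. v \<in> e}"

definition zagreb1 :: "'v sgraph \<Rightarrow> nat" where
  "zagreb1 \<Gamma> = (\<Sum>v\<in>verts \<Gamma>. (degree \<Gamma> v)\<^sup>2)"

text \<open>For an edge \<open>e = {u, v}\<close> with \<open>u \<noteq> v\<close> the inner product is \<open>deg(u) deg(v)\<close>.\<close>

definition zagreb2 :: "'v sgraph \<Rightarrow> nat" where
  "zagreb2 \<Gamma> = (\<Sum>e\<in>edges \<Gamma>. \<Prod>v\<in>e. degree \<Gamma> v)"

definition conjugacy_class :: "('g, 'c) monoid_scheme \<Rightarrow> 'g \<Rightarrow> 'g set" where
  "conjugacy_class G x = {g \<otimes>\<^bsub>G\<^esub> x \<otimes>\<^bsub>G\<^esub> inv\<^bsub>G\<^esub> g | g. g \<in> carrier G}"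

definition center :: "('g, 'c) monoid_scheme \<Rightarrow> 'g set" where
  "center G = {z \<in> carrier G. \<forall>g\<in>carrier G. z \<otimes>\<^bsub>G\<^esub> g = g \<otimes>\<^bsub>G\<^esub> z}"

definition noncentral_classes :: "('g, 'c) monoid_scheme \<Rightarrow> 'g set set" where
  "noncentral_classes G = conjugacy_class G ` (carrier G - center G)"

definition CCC :: "('g, 'c) monoid_scheme \<Rightarrow> 'g set sgraph" where
  "CCC G =
     (noncentral_classes G,
      {{X, Y} | X Y. X \<in> noncentral_classes G \<and> Y \<in> noncentral_classes G \<and> X \<noteq> Y \<and>
         (\<exists>x\<in>X. \<exists>y\<in>Y. x \<otimes>\<^bsub>G\<^esub> y = y \<otimes>\<^bsub>G\<^esub> x)})"

end

theory Submission
  imports Defs "HOL-Number_Theory.Cong"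
begin

text \<open>
  In \<open>V8m m\<close> one has \<open>b^j a^k = a^(s k) b^(t j)\<close> with the signs \<open>s = (-1)^j\<close> and \<open>t = (-1)^k\<close>.
  The resulting product of normal forms \<open>a^i b^j\<close> is already associative for integer exponents, so
  reading words as pairs \<open>(i, j)\<close> modulo \<open>(2m, 4)\<close> is well defined and distinguishes the \<open>8m\<close>
  elements.
  The elements with \<open>j\<close> even form an abelian subgroup, whose noncentral classes are pairs and hence
  form one clique. An element with \<open>j\<close> odd commutes with a noncentral \<open>a^k b^l\<close> only if \<open>l\<close> is odd and
  \<open>k\<close> has the parity of \<open>i\<close>; each parity of \<open>i\<close> contributes two adjacent classes if \<open>m\<close> is even and a
  single class if \<open>m\<close> is odd. So the graph is a disjoint union of three complete graphs. Comparing
  the two averages then amounts, for \<open>m\<close> even and \<open>x = 2m - 3\<close>, to \<open>((x + 1) (x - 1))\<^sup>2 \<ge> 0\<close>.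
\<close>

section \<open>Normal forms\<close>

definition parity_sign :: "int \<Rightarrow> int" where
  "parity_sign i = (if even i then 1 else - 1)"

lemma parity_sign_simps [simp]:
  "parity_sign 0 = 1" "parity_sign 1 = - 1" "parity_sign (- i) = parity_sign i"
  "parity_sign (i + 1) = - parity_sign i" "parity_sign (i - 1) = - parity_sign i"
  by (auto simp: parity_sign_def)

lemma odd_parity_sign [simp]: "even (parity_sign i) \<longleftrightarrow> False"
  by (simp add: parity_sign_def)

fun nf_mult :: "int \<times> int \<Rightarrow> int \<times> int \<Rightarrow> int \<times> int" where
  "nf_mult (i, j) (k, l) = (i + parity_sign j * k, parity_sign k * j + l)"

text \<open>\<open>parity_sign\<close> turns sums into products and ignores the sign of its
  argument, so both bracketings collect the same signs. No reduction modulo \<open>2m\<close> or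
  \<open>4\<close> is involved.\<close>

lemma nf_mult_assoc: "nf_mult (nf_mult x y) z = nf_mult x (nf_mult y z)"
  by (cases x; cases y; cases z) (auto simp: parity_sign_def algebra_simps)

fun letter_nf :: "generator letter \<Rightarrow> int \<times> int" where
  "letter_nf (Gen generator.a) = (1, 0)"
| "letter_nf (Inv generator.a) = (- 1, 0)"
| "letter_nf (Gen generator.b) = (0, 1)"
| "letter_nf (Inv generator.b) = (0, - 1)"

fun word_nf :: "generator word \<Rightarrow> int \<times> int" where
  "word_nf [] = (0, 0)"
| "word_nf (x # u) = nf_mult (letter_nf x) (word_nf u)"

lemma nf_mult_0_left [simp]: "nf_mult (0, 0) x = x"
  by (cases x) simp

lemma word_nf_append: "word_nf (u @ v) = nf_mult (word_nf u) (word_nf v)"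
  by (induction u) (auto simp: nf_mult_assoc)

lemma word_nf_replicate:
  "word_nf (replicate n (Gen generator.a)) = (int n, 0)"
  "word_nf (replicate n (Inv generator.a)) = (- int n, 0)"
  "word_nf (replicate n (Gen generator.b)) = (0, int n)"
  "word_nf (replicate n (Inv generator.b)) = (0, - int n)"
  by (induction n) auto

text \<open>This carries facts from words over to arbitrary integer pairs, in particular the
  multiplication rule.\<close>

lemma word_nf_surj: obtains u where "word_nf u = x"
proof -
  obtain i j where x: "x = (i, j)" by (cases x)
  have "\<exists>u. word_nf u = (i, 0)"
    by (cases i) (metis word_nf_replicate(1), metis word_nf_replicate(2))
  moreover have "\<exists>u. word_nf u = (0, j)"
    by (cases j) (metis word_nf_replicate(3), metis word_nf_replicate(4))
  ultimately obtain u v where "word_nf u = (i, 0)" "word_nf v = (0, j)" by blast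
  then have "word_nf (u @ v) = x" by (simp add: word_nf_append x)
  with that show ?thesis .
qed

section \<open>Compatibility of normal forms with the defining relations\<close>

definition nf_cong :: "nat \<Rightarrow> int \<times> int \<Rightarrow> int \<times> int \<Rightarrow> bool" where
  "nf_cong m x y \<longleftrightarrow> [fst x = fst y] (mod 2 * int m) \<and> [snd x = snd y] (mod 4)"

lemma nf_cong_refl [simp]: "nf_cong m x x"
  by (simp add: nf_cong_def)

lemma nf_cong_sym: "nf_cong m x y \<Longrightarrow> nf_cong m y x"
  by (simp add: nf_cong_def cong_sym)

lemma nf_cong_trans: "nf_cong m x y \<Longrightarrow> nf_cong m y z \<Longrightarrow> nf_cong m x z"
  unfolding nf_cong_def by (blast intro: cong_trans)

text \<open>The modulus has the shape \<open>2 * n\<close> so that both coordinates are covered: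
  \<open>2m\<close> directly and \<open>4\<close> as \<open>2 * 2\<close>.\<close>

lemma cong_imp_even_iff:
  fixes i k :: int
  assumes "[i = k] (mod 2 * n)"
  shows "even i \<longleftrightarrow> even k"
  using cong_dvd_iff[OF cong_modulus_mult[OF assms]] by simp

lemma parity_sign_cong: "[i = k] (mod 2 * n) \<Longrightarrow> parity_sign i = parity_sign k"
  using cong_imp_even_iff by (auto simp: parity_sign_def)

text \<open>Both moduli are even, so the signs in \<open>nf_mult\<close> depend only on
  residues.\<close>

lemma nf_cong_mult:
  assumes "nf_cong m x x'" "nf_cong m y y'"
  shows "nf_cong m (nf_mult x y) (nf_mult x' y')"
proof -
  obtain i j k l i' j' k' l' where
    eqs: "x = (i, j)" "y = (k, l)" "x' = (i', j')" "y' = (k', l')"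
    by (metis surj_pair)
  have i: "[i = i'] (mod 2 * int m)" and j: "[j = j'] (mod 4)"
    and k: "[k = k'] (mod 2 * int m)" and l: "[l = l'] (mod 4)"
    using assms by (auto simp: eqs nf_cong_def)
  have "parity_sign k = parity_sign k'" "parity_sign j = parity_sign j'"
    using parity_sign_cong[OF k] parity_sign_cong[of j j' 2] j by auto
  then show ?thesis
    using i j k l by (simp add: eqs nf_cong_def cong_add cong_scalar_left)
qed

text \<open>Cancellations and relations all preserve the exponents modulo \<open>(2m, 4)\<close>.
  This invariant keeps incongruent normal forms from collapsing in the group.\<close>

lemma word_eq_imp_nf_cong:
  "word_eq (V8m_relations m) u v \<Longrightarrow> nf_cong m (word_nf u) (word_nf v)"
proof (induction rule: word_eq.induct)
  case (word_eq_append u u' v v')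
  then show ?case by (simp add: word_nf_append nf_cong_mult)
next
  case (word_eq_Gen_Inv x)
  then show ?case by (cases x) auto
next
  case (word_eq_Inv_Gen x)
  then show ?case by (cases x) auto
next
  case (word_eq_relation u v)
  then consider "u = replicate (2 * m) (Gen generator.a)" "v = []"
    | "u = replicate 4 (Gen generator.b)" "v = []"
    | "u = [Gen generator.b, Gen generator.a]" "v = [Inv generator.a, Inv generator.b]"
    | "u = [Inv generator.b, Gen generator.a]" "v = [Inv generator.a, Gen generator.b]"
    unfolding V8m_relations_def by blast
  then show ?case
  proof cases
    case 2
    then show ?thesis by (simp only: word_nf_replicate) (simp add: nf_cong_def cong_def)
  qed (auto simp: word_nf_replicate nf_cong_def cong_def)
qed (auto intro: nf_cong_sym nf_cong_trans)

text \<open>When \<open>B\<close> or \<open>inv B\<close> passes a single \<open>A\<close> or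
  \<open>inv A\<close>, both factors are inverted; passing \<open>i\<close> of them therefore leaves
  the sign \<open>(-1)^i\<close> on the exponent of \<open>B\<close>.\<close>

lemma (in group) twisted_commutation:
  fixes i :: int
  assumes A: "A \<in> carrier G" and B: "B \<in> carrier G"
    and r1: "B \<otimes> A = inv A \<otimes> inv B" and r2: "inv B \<otimes> A = inv A \<otimes> B"
  shows "B \<otimes> A [^] i = A [^] (- i) \<otimes> B [^] parity_sign i \<and>
    inv B \<otimes> A [^] i = A [^] (- i) \<otimes> B [^] (- parity_sign i)"
proof -
  \<comment> \<open>The rules for passing \<open>inv A\<close> are the given relations multiplied by
    \<open>A\<close> on the left and \<open>inv A\<close> on the right: \<open>r3\<close> comes from
    \<open>r2\<close>, and \<open>r4\<close> from \<open>r1\<close>.\<close>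
  have r3: "B \<otimes> inv A = A \<otimes> inv B"
  proof -
    have "A \<otimes> (inv B \<otimes> A) \<otimes> inv A = A \<otimes> (inv A \<otimes> B) \<otimes> inv A"
      by (simp only: r2)
    moreover have "A \<otimes> (inv B \<otimes> A) \<otimes> inv A = A \<otimes> inv B"
      using A B by (simp add: m_assoc)
    moreover have "A \<otimes> (inv A \<otimes> B) \<otimes> inv A = B \<otimes> inv A"
      using A B by (simp flip: m_assoc)
    ultimately show ?thesis by simp
  qed
  have r4: "inv B \<otimes> inv A = A \<otimes> B"
  proof -
    have "A \<otimes> (B \<otimes> A) \<otimes> inv A = A \<otimes> (inv A \<otimes> inv B) \<otimes> inv A"
      by (simp only: r1)
    moreover have "A \<otimes> (B \<otimes> A) \<otimes> inv A = A \<otimes> B"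
      using A B by (simp add: m_assoc)
    moreover have "A \<otimes> (inv A \<otimes> inv B) \<otimes> inv A = inv B \<otimes> inv A"
      using A B by (simp flip: m_assoc)
    ultimately show ?thesis by simp
  qed
  have pm: "parity_sign i = 1 \<or> parity_sign i = - 1" for i
    by (simp add: parity_sign_def)
  have right: "B [^] parity_sign i \<otimes> A = inv A \<otimes> B [^] (- parity_sign i)"
    "B [^] parity_sign i \<otimes> inv A = A \<otimes> B [^] (- parity_sign i)"
    "B [^] (- parity_sign i) \<otimes> A = inv A \<otimes> B [^] parity_sign i"
    "B [^] (- parity_sign i) \<otimes> inv A = A \<otimes> B [^] parity_sign i" for i
    using pm[of i] A B r1 r2 r3 r4 by (elim disjE; simp add: int_pow_neg)+
  \<comment> \<open>\<open>C\<close> is the factor to be moved, \<open>D\<close> what it becomes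
    after passing \<open>A [^] i\<close>, and \<open>D'\<close> what \<open>D\<close> becomes after
    passing one more factor \<open>A'\<close>, which turns into \<open>A''\<close>.\<close>
  have move: "C \<otimes> (A [^] i \<otimes> A') = A [^] (- i) \<otimes> A'' \<otimes> D'"
    if "C \<otimes> A [^] i = A [^] (- i) \<otimes> D" "D \<otimes> A' = A'' \<otimes> D'"
      "A' \<in> carrier G" "A'' \<in> carrier G" "C \<in> carrier G" "D \<in> carrier G" "D' \<in> carrier G"
    for C D D' A' A'' and i :: int
  proof -
    have "C \<otimes> (A [^] i \<otimes> A') = (C \<otimes> A [^] i) \<otimes> A'"
      using that(3-) A by (simp add: m_assoc)
    also have "\<dots> = A [^] (- i) \<otimes> (D \<otimes> A')"
      unfolding that(1) using that(3-) A by (simp add: m_assoc)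
    also have "\<dots> = A [^] (- i) \<otimes> A'' \<otimes> D'"
      unfolding that(2) using that(3-) A by (simp add: m_assoc)
    finally show ?thesis .
  qed
  show ?thesis
  proof (induction i rule: int_induct[where k = 0])
    case base
    then show ?case using A B by (simp add: int_pow_neg)
  next
    case (step1 i)
    have "A [^] (i + 1) = A [^] i \<otimes> A" "A [^] (- (i + 1)) = A [^] (- i) \<otimes> inv A"
      using A int_pow_mult[of A i 1] int_pow_mult[of A "- i" "- 1"] by (auto simp: int_pow_neg)
    moreover have "B \<otimes> (A [^] i \<otimes> A) = A [^] (- i) \<otimes> inv A \<otimes> B [^] (- parity_sign i)"
      by (rule move[OF _ right(1)[of i]]) (use step1 A B in auto)
    moreover have "inv B \<otimes> (A [^] i \<otimes> A) = A [^] (- i) \<otimes> inv A \<otimes> B [^] parity_sign i"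
      by (rule move[OF _ right(3)[of i]]) (use step1 A B in auto)
    ultimately show ?case by (simp only: parity_sign_simps minus_minus simp_thms)
  next
    case (step2 i)
    have "A [^] (i - 1) = A [^] i \<otimes> inv A" "A [^] (- (i - 1)) = A [^] (- i) \<otimes> A"
      using A int_pow_mult[of A i "- 1"] int_pow_mult[of A "- i" 1] by (auto simp: int_pow_neg)
    moreover have "B \<otimes> (A [^] i \<otimes> inv A) = A [^] (- i) \<otimes> A \<otimes> B [^] (- parity_sign i)"
      by (rule move[OF _ right(2)[of i]]) (use step2 A B in auto)
    moreover have "inv B \<otimes> (A [^] i \<otimes> inv A) = A [^] (- i) \<otimes> A \<otimes> B [^] parity_sign i"
      by (rule move[OF _ right(4)[of i]]) (use step2 A B in auto)
    ultimately show ?case by (simp only: parity_sign_simps minus_minus simp_thms)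
  qed
qed

section \<open>Group elements and their normal forms\<close>

definition gen_class :: "nat \<Rightarrow> generator \<Rightarrow> generator word set" where
  "gen_class m x = word_class (V8m_relations m) [Gen x]"

definition elt :: "nat \<Rightarrow> int \<times> int \<Rightarrow> generator word set" where
  "elt m x = gen_class m generator.a [^]\<^bsub>V8m m\<^esub> fst x
     \<otimes>\<^bsub>V8m m\<^esub> gen_class m generator.b [^]\<^bsub>V8m m\<^esub> snd x"

lemma group_V8m: "group (V8m m)"
  by (simp add: V8m_def group_presented_group)

lemma gen_class_closed: "gen_class m x \<in> carrier (V8m m)"
  by (simp add: V8m_def gen_class_def carrier_presented_group)

lemma inv_gen_class: "inv\<^bsub>V8m m\<^esub> gen_class m x = word_class (V8m_relations m) [Inv x]"
proof -
  interpret group "V8m m" by (rule group_V8m)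
  have "word_class (V8m_relations m) [Inv x] \<otimes>\<^bsub>V8m m\<^esub> gen_class m x = \<one>\<^bsub>V8m m\<^esub>"
    by (simp add: V8m_def gen_class_def mult_presented_group one_presented_group
        word_class_eq_iff word_eq_Inv_Gen)
  then show ?thesis
    by (rule inv_equality) (auto simp: V8m_def gen_class_def carrier_presented_group)
qed

lemma word_class_Cons:
  "word_class (V8m_relations m) (l # u) =
     word_class (V8m_relations m) [l] \<otimes>\<^bsub>V8m m\<^esub> word_class (V8m_relations m) u"
  by (simp add: V8m_def mult_presented_group)

lemma word_class_replicate_Gen:
  "word_class (V8m_relations m) (replicate n (Gen x)) = gen_class m x [^]\<^bsub>V8m m\<^esub> n"
proof -
  interpret group "V8m m" by (rule group_V8m)
  show ?thesis
  proof (induction n)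
    case 0
    then show ?case by (simp add: V8m_def one_presented_group)
  next
    case (Suc n)
    then show ?case
      by (simp only: replicate_Suc word_class_Cons[of m "Gen x" "replicate n (Gen x)"] gen_class_def[symmetric]
          nat_pow_Suc2[OF gen_class_closed])
  qed
qed

text \<open>Prepending \<open>a\<close> or its inverse to a normal form only shifts the first
  exponent; prepending \<open>b\<close> or its inverse is rewritten by
  \<open>twisted_commutation\<close>. So the relations suffice to bring every word into normal
  form.\<close>

lemma word_class_eq_elt: "word_class (V8m_relations m) u = elt m (word_nf u)"
proof (induction u)
  case Nil
  interpret group "V8m m" by (rule group_V8m)
  have "word_class (V8m_relations m) [] = \<one>\<^bsub>V8m m\<^esub>"
    by (simp add: V8m_def one_presented_group)
  then show ?case by (simp add: elt_def)
next
  case (Cons l u)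
  interpret group "V8m m" by (rule group_V8m)
  let ?A = "gen_class m generator.a" and ?B = "gen_class m generator.b"
  obtain i j where ij: "word_nf u = (i, j)" by (cases "word_nf u")
  have A: "?A \<in> carrier (V8m m)" and B: "?B \<in> carrier (V8m m)"
    by (simp_all add: gen_class_closed)
  have "word_eq (V8m_relations m) [Gen generator.b, Gen generator.a] [Inv generator.a, Inv generator.b]"
    "word_eq (V8m_relations m) [Inv generator.b, Gen generator.a] [Inv generator.a, Gen generator.b]"
    by (rule word_eq_relation, simp add: V8m_relations_def)+
  then have "?B \<otimes>\<^bsub>V8m m\<^esub> ?A = inv\<^bsub>V8m m\<^esub> ?A \<otimes>\<^bsub>V8m m\<^esub> inv\<^bsub>V8m m\<^esub> ?B"
    "inv\<^bsub>V8m m\<^esub> ?B \<otimes>\<^bsub>V8m m\<^esub> ?A = inv\<^bsub>V8m m\<^esub> ?A \<otimes>\<^bsub>V8m m\<^esub> ?B"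
    unfolding inv_gen_class unfolding gen_class_def V8m_def mult_presented_group word_class_eq_iff
    by simp_all
  note tw = twisted_commutation[OF A B this, of i]
  have "word_class (V8m_relations m) [l] \<otimes>\<^bsub>V8m m\<^esub> elt m (i, j) = elt m (nf_mult (letter_nf l) (i, j))"
  proof (cases l rule: letter_nf.cases)
    case 1
    then show ?thesis
      using A B int_pow_mult[OF A, of 1 i] by (simp add: elt_def gen_class_def[symmetric] m_assoc)
  next
    case 2
    then show ?thesis
      using A B int_pow_mult[OF A, of "- 1" i]
      by (simp add: elt_def inv_gen_class[symmetric] m_assoc int_pow_neg)
  next
    case 3
    have "?B \<otimes>\<^bsub>V8m m\<^esub> (?A [^]\<^bsub>V8m m\<^esub> i \<otimes>\<^bsub>V8m m\<^esub> ?B [^]\<^bsub>V8m m\<^esub> j) =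
      ?A [^]\<^bsub>V8m m\<^esub> (- i) \<otimes>\<^bsub>V8m m\<^esub> ?B [^]\<^bsub>V8m m\<^esub> (parity_sign i + j)"
      using tw int_pow_mult[OF B, of "parity_sign i" j] A B by (metis int_pow_closed m_assoc)
    with 3 show ?thesis by (simp add: elt_def flip: gen_class_def)
  next
    case 4
    have "inv\<^bsub>V8m m\<^esub> ?B \<otimes>\<^bsub>V8m m\<^esub> (?A [^]\<^bsub>V8m m\<^esub> i \<otimes>\<^bsub>V8m m\<^esub> ?B [^]\<^bsub>V8m m\<^esub> j) =
      ?A [^]\<^bsub>V8m m\<^esub> (- i) \<otimes>\<^bsub>V8m m\<^esub> ?B [^]\<^bsub>V8m m\<^esub> (- parity_sign i + j)"
      using tw int_pow_mult[OF B, of "- parity_sign i" j] A B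
      by (metis int_pow_closed inv_closed m_assoc)
    with 4 show ?thesis by (simp add: elt_def flip: inv_gen_class)
  qed
  then show ?case
    by (simp add: word_class_Cons[of m l u] Cons ij)
qed

text \<open>No computation in the group is needed: both pairs are values of words, and words
  multiply by concatenation.\<close>

lemma elt_mult: "elt m x \<otimes>\<^bsub>V8m m\<^esub> elt m y = elt m (nf_mult x y)"
proof -
  obtain u v where "word_nf u = x" "word_nf v = y" by (metis word_nf_surj)
  then show ?thesis
    by (auto simp flip: word_class_eq_elt word_nf_append simp: V8m_def mult_presented_group)
qed

lemma carrier_V8m: "carrier (V8m m) = range (elt m)"
proof -
  have "elt m x \<in> range (word_class (V8m_relations m))" for x
    by (metis word_nf_surj word_class_eq_elt rangeI)
  then show ?thesis
    by (auto simp: V8m_def carrier_presented_group word_class_eq_elt)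
qed

text \<open>Left to right is the invariant of words; right to left is \<open>a^(2m) = 1\<close> and
  \<open>b^4 = 1\<close>.\<close>

lemma elt_eq_iff: "elt m x = elt m y \<longleftrightarrow> nf_cong m x y"
proof
  assume eq: "elt m x = elt m y"
  obtain u v where "word_nf u = x" "word_nf v = y" by (metis word_nf_surj)
  with eq show "nf_cong m x y"
    using word_eq_imp_nf_cong[of m u v] by (simp add: word_class_eq_elt flip: word_class_eq_iff)
next
  assume "nf_cong m x y"
  then obtain p q where p: "fst y = fst x + 2 * int m * p" and q: "snd y = snd x + 4 * q"
    by (auto simp: nf_cong_def cong_iff_lin)
  interpret group "V8m m" by (rule group_V8m)
  have "word_eq (V8m_relations m) (replicate (2 * m) (Gen generator.a)) []"
    "word_eq (V8m_relations m) (replicate 4 (Gen generator.b)) []"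
    by (rule word_eq_relation, simp add: V8m_relations_def)+
  then have "gen_class m generator.a [^]\<^bsub>V8m m\<^esub> (2 * m) = \<one>\<^bsub>V8m m\<^esub>"
    "gen_class m generator.b [^]\<^bsub>V8m m\<^esub> (4 :: nat) = \<one>\<^bsub>V8m m\<^esub>"
    by (simp_all only: word_class_eq_iff[symmetric] word_class_replicate_Gen)
      (simp_all add: V8m_def one_presented_group)
  then have "gen_class m generator.a [^]\<^bsub>V8m m\<^esub> (2 * int m) = \<one>\<^bsub>V8m m\<^esub>"
    "gen_class m generator.b [^]\<^bsub>V8m m\<^esub> (4 :: int) = \<one>\<^bsub>V8m m\<^esub>"
    using int_pow_int[of "V8m m" "gen_class m generator.a" "2 * m"]
      int_pow_int[of "V8m m" "gen_class m generator.b" 4] by simp_all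
  then show "elt m x = elt m y"
    by (simp add: elt_def p q gen_class_closed int_pow_mult flip: int_pow_pow)
qed

section \<open>Conjugacy classes\<close>

text \<open>This form is free of inverses, so conjugacy can be expressed on integer pairs through
  \<open>nf_mult\<close> alone.\<close>

lemma (in group) mem_conjugacy_class_iff:
  assumes "x \<in> carrier G" "y \<in> carrier G"
  shows "y \<in> conjugacy_class G x \<longleftrightarrow> (\<exists>g\<in>carrier G. y \<otimes> g = g \<otimes> x)"
proof -
  have "y = g \<otimes> x \<otimes> inv g \<longleftrightarrow> y \<otimes> g = g \<otimes> x" if "g \<in> carrier G" for g
    using inv_solve_right[of y "g \<otimes> x" g] assms that by auto
  then show ?thesis unfolding conjugacy_class_def by blast
qed

lemma (in group) conjugacy_class_eq_iff:
  assumes x: "x \<in> carrier G" and y: "y \<in> carrier G"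
  shows "conjugacy_class G x = conjugacy_class G y \<longleftrightarrow> y \<in> conjugacy_class G x"
proof
  assume "conjugacy_class G x = conjugacy_class G y"
  moreover have "y \<in> conjugacy_class G y"
    using y by (auto simp: mem_conjugacy_class_iff intro!: bexI[of _ \<one>])
  ultimately show "y \<in> conjugacy_class G x" by simp
next
  assume "y \<in> conjugacy_class G x"
  then obtain g where g: "g \<in> carrier G" and y_eq: "y = g \<otimes> x \<otimes> inv g"
    by (auto simp: conjugacy_class_def)
  have "\<exists>k. h \<otimes> y \<otimes> inv h = k \<otimes> x \<otimes> inv k \<and> k \<in> carrier G" if "h \<in> carrier G" for h
    using that g x by (intro exI[of _ "h \<otimes> g"]) (simp add: y_eq m_assoc inv_mult_group)
  moreover have "\<exists>k. h \<otimes> x \<otimes> inv h = k \<otimes> y \<otimes> inv k \<and> k \<in> carrier G" if "h \<in> carrier G" for h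
  proof -
    have "inv g \<otimes> (g \<otimes> z) = z" if "z \<in> carrier G" for z
      using that g by (simp flip: m_assoc)
    then show ?thesis
      using that g x by (intro exI[of _ "h \<otimes> inv g"]) (simp add: y_eq m_assoc inv_mult_group)
  qed
  ultimately show "conjugacy_class G x = conjugacy_class G y"
    unfolding conjugacy_class_def by blast
qed

definition cls :: "nat \<Rightarrow> int \<times> int \<Rightarrow> generator word set set" where
  "cls m x = conjugacy_class (V8m m) (elt m x)"

text \<open>The equation \<open>y g = g x\<close> read on exponents, with \<open>y\<close> the
  conjugate of \<open>x\<close> by \<open>g\<close>.\<close>

definition nf_conj :: "nat \<Rightarrow> int \<times> int \<Rightarrow> int \<times> int \<Rightarrow> bool" where
  "nf_conj m x y \<longleftrightarrow> (\<exists>g. nf_cong m (nf_mult y g) (nf_mult g x))"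

lemma elt_closed: "elt m x \<in> carrier (V8m m)"
  by (simp add: carrier_V8m)

lemma elt_mem_cls_iff: "elt m y \<in> cls m x \<longleftrightarrow> nf_conj m x y"
  unfolding cls_def nf_conj_def
  unfolding group.mem_conjugacy_class_iff[OF group_V8m elt_closed elt_closed] carrier_V8m bex_simps
    elt_mult elt_eq_iff ..

lemma cls_eq_iff: "cls m x = cls m y \<longleftrightarrow> nf_conj m x y"
  unfolding elt_mem_cls_iff[symmetric]
  unfolding cls_def by (rule group.conjugacy_class_eq_iff[OF group_V8m elt_closed elt_closed])

lemma cls_eq_image: "cls m x = elt m ` {y. nf_conj m x y}"
proof -
  have "cls m x \<subseteq> range (elt m)"
    unfolding cls_def conjugacy_class_def carrier_V8m[symmetric]
    using group_V8m elt_closed[of m x] by (auto simp: group.is_monoid group.inv_closed monoid.m_closed)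
  then show ?thesis using elt_mem_cls_iff[of m _ x] by blast
qed

section \<open>The center\<close>

definition nf_central :: "nat \<Rightarrow> int \<times> int \<Rightarrow> bool" where
  "nf_central m x \<longleftrightarrow> even (fst x) \<and> even (snd x) \<and> int m dvd fst x"

lemma cong_double_iff: "[i = - i] (mod 2 * int m) \<longleftrightarrow> int m dvd i"
proof -
  have "[i = - i] (mod 2 * int m) \<longleftrightarrow> 2 * int m dvd 2 * i"
    by (simp add: cong_iff_dvd_diff)
  then show ?thesis by (simp del: dvd_mult_cancel_left) 
qed

lemma cong_4_iff: "[i = j] (mod 4) \<longleftrightarrow> (4 :: int) dvd i - j"
  by (simp add: cong_iff_dvd_diff)

text \<open>It is enough to test against the two generators. For \<open>m \<ge> 1\<close> the center
  has four elements if \<open>m\<close> is even (first exponent \<open>0\<close> or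
  \<open>m\<close>, second \<open>0\<close> or \<open>2\<close>) and two if \<open>m\<close> is odd,
  where the parity condition rules out \<open>m\<close>.\<close>

lemma elt_central_iff: "elt m x \<in> center (V8m m) \<longleftrightarrow> nf_central m x"
proof -
  obtain i j where x: "x = (i, j)" by (cases x)
  have "elt m x \<in> center (V8m m) \<longleftrightarrow> (\<forall>y. nf_cong m (nf_mult x y) (nf_mult y x))"
    unfolding center_def carrier_V8m
    by (simp only: mem_Collect_eq rangeI ball_simps elt_mult elt_eq_iff simp_thms)
  also have "\<dots> \<longleftrightarrow> nf_central m x"
  proof
    assume *: "\<forall>y. nf_cong m (nf_mult x y) (nf_mult y x)"
    \<comment> \<open>Commuting with \<open>b\<close> forces \<open>m\<close> to divide
      \<open>i\<close> and \<open>i\<close> to be even; commuting with \<open>a\<close>, below,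
      forces \<open>j\<close> to be even.\<close>
    have "[i = - i] (mod 2 * int m)" and "[j + 1 = parity_sign i + j] (mod 4)"
      using *[rule_format, of "(0, 1)"] by (auto simp: x nf_cong_def)
    moreover have "[- j = j] (mod 4)"
      using *[rule_format, of "(1, 0)"] by (auto simp: x nf_cong_def)
    ultimately show "nf_central m x"
      by (auto simp: nf_central_def x cong_double_iff cong_4_iff parity_sign_def split: if_splits)
  next
    assume *: "nf_central m x"
    show "\<forall>y. nf_cong m (nf_mult x y) (nf_mult y x)"
    proof
      fix y :: "int \<times> int"
      obtain k l where y: "y = (k, l)" by (cases y)
      have "[i = - i] (mod 2 * int m)" and "[parity_sign k * j = j] (mod 4)"
        using * by (auto simp: nf_central_def x cong_double_iff cong_4_iff parity_sign_def)
      then have "[i = parity_sign l * i] (mod 2 * int m)"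
        by (simp add: parity_sign_def)
      then have "[k + i = k + parity_sign l * i] (mod 2 * int m)"
        by (simp only: cong_add_lcancel)
      moreover have "[parity_sign k * j + l = j + l] (mod 4)"
        using \<open>[parity_sign k * j = j] (mod 4)\<close> by (simp only: cong_add_rcancel)
      ultimately show "nf_cong m (nf_mult x y) (nf_mult y x)"
        using * by (simp add: nf_central_def x y nf_cong_def parity_sign_def add.commute)
    qed
  qed
  finally show ?thesis .
qed

lemma noncentral_classes_V8m: "noncentral_classes (V8m m) = cls m ` {x. \<not> nf_central m x}"
  unfolding noncentral_classes_def cls_def
  by (auto simp: carrier_V8m simp flip: elt_central_iff)

section \<open>Invariants of classes and commuting classes\<close>

definition nf_part :: "int \<times> int \<Rightarrow> nat" where
  "nf_part x = (if even (snd x) then 0 else if even (fst x) then 1 else 2)"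

text \<open>Modulo 2 all signs disappear and \<open>nf_mult\<close> is plain addition, where
  conjugation is trivial.\<close>

lemma nf_conj_parity:
  assumes "nf_conj m x y"
  shows "even (fst x) \<longleftrightarrow> even (fst y)" "even (snd x) \<longleftrightarrow> even (snd y)"
proof -
  obtain g where g: "nf_cong m (nf_mult y g) (nf_mult g x)"
    using assms by (auto simp: nf_conj_def)
  obtain i j k l p q where eqs: "x = (i, j)" "y = (k, l)" "g = (p, q)"
    by (metis surj_pair)
  have "[k + parity_sign l * p = p + parity_sign q * i] (mod 2 * int m)"
    "[parity_sign p * l + q = parity_sign i * q + j] (mod 2 * 2)"
    using g by (auto simp: eqs nf_cong_def)
  from this[THEN cong_imp_even_iff] show "even (fst x) \<longleftrightarrow> even (fst y)"
    "even (snd x) \<longleftrightarrow> even (snd y)"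
    by (auto simp: eqs)
qed

lemma nf_part_conj: "nf_conj m x y \<Longrightarrow> nf_part x = nf_part y"
  by (simp add: nf_part_def nf_conj_parity)

text \<open>For an even second exponent, conjugation changes the first one modulo \<open>2m\<close>
  by a sign at most, which does not affect divisibility by \<open>m\<close>. For an odd one neither
  element is central.\<close>

lemma nf_central_conj:
  assumes "nf_conj m x y"
  shows "nf_central m x \<longleftrightarrow> nf_central m y"
proof -
  obtain g where g: "nf_cong m (nf_mult y g) (nf_mult g x)"
    using assms by (auto simp: nf_conj_def)
  obtain i j k l p q where eqs: "x = (i, j)" "y = (k, l)" "g = (p, q)"
    by (metis surj_pair)
  have fst: "[k + parity_sign l * p = p + parity_sign q * i] (mod int m * 2)"
    using g by (auto simp: eqs nf_cong_def mult.commute)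
  have "int m dvd k \<longleftrightarrow> int m dvd i" if "even l"
  proof -
    have "[k + p = parity_sign q * i + p] (mod int m)"
      using cong_modulus_mult[OF fst] that by (simp add: parity_sign_def add.commute)
    then have "int m dvd k - parity_sign q * i"
      by (simp add: cong_iff_dvd_diff)
    then have "int m dvd k \<longleftrightarrow> int m dvd parity_sign q * i"
      by (simp add: cong_dvd_iff flip: cong_iff_dvd_diff)
    then show ?thesis by (simp add: parity_sign_def split: if_splits)
  qed
  then show ?thesis
    using nf_conj_parity[OF assms] by (auto simp: eqs nf_central_def)
qed

text \<open>Noncentrality enters only to keep even and odd second exponents apart; the parity of the
  first exponent is then read off the second coordinate modulo 4.\<close>

lemma nf_commute_imp_part_eq:
  assumes "nf_cong m (nf_mult x y) (nf_mult y x)" "\<not> nf_central m x" "\<not> nf_central m y"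
  shows "nf_part x = nf_part y"
proof -
  \<comment> \<open>If \<open>j\<close> is even and \<open>l\<close> odd, the first coordinates give
    \<open>2 i = 0\<close> modulo \<open>2m\<close>, and the second ones
    \<open>(1 - parity_sign i) * l = 0\<close> modulo 4, so \<open>i\<close> is even and
    \<open>x\<close> would be central.\<close>
  have even_imp: "even (snd y)" 
    if comm: "nf_cong m (nf_mult x y) (nf_mult y x)" and "\<not> nf_central m x" "even (snd x)" for x y
  proof (rule ccontr)
    assume odd: "odd (snd y)"
    obtain i j k l where eqs: "x = (i, j)" "y = (k, l)" by (metis surj_pair)
    have "[k + i = k - i] (mod 2 * int m)" "[parity_sign k * j + l = parity_sign i * l + j] (mod 4)"
      using comm odd \<open>even (snd x)\<close> by (auto simp: eqs nf_cong_def parity_sign_def add.commute)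
    then have "int m dvd i" "4 dvd parity_sign k * j + l - (parity_sign i * l + j)"
      using cong_double_iff[of i m] by (simp_all add: cong_iff_dvd_diff)
    moreover from this(2) have "even i"
      using odd \<open>even (snd x)\<close> unfolding eqs parity_sign_def by (simp split: if_splits) presburger+
    ultimately have "nf_central m x"
      using \<open>even (snd x)\<close> by (simp add: nf_central_def eqs)
    with \<open>\<not> nf_central m x\<close> show False ..
  qed
  have snd: "even (snd x) \<longleftrightarrow> even (snd y)"
    using even_imp[of x y] even_imp[of y x] assms nf_cong_sym by blast
  \<comment> \<open>For \<open>j\<close> and \<open>l\<close> odd,
    \<open>(parity_sign k - 1) * j\<close> and \<open>(parity_sign i - 1) * l\<close> agree modulo
    4; each is 0 or 2 according to the parity of \<open>k\<close> or \<open>i\<close>.\<close>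
  moreover have "even (fst x) \<longleftrightarrow> even (fst y)" if "odd (snd x)"
  proof -
    obtain i j k l where eqs: "x = (i, j)" "y = (k, l)" by (metis surj_pair)
    have "4 dvd parity_sign k * j + l - (parity_sign i * l + j)"
      using assms(1) by (simp add: eqs nf_cong_def cong_iff_dvd_diff)
    then show ?thesis
      using that snd unfolding eqs parity_sign_def by (simp split: if_splits) presburger+
  qed
  ultimately show ?thesis by (simp add: nf_part_def)
qed

text \<open>For an odd second exponent, conjugation by \<open>a^p\<close> adds \<open>2p\<close> to
  the first exponent and multiplies the second by \<open>(-1)^p\<close>. So the first can be reduced
  to its parity while the second stays odd.\<close>

lemma nf_conj_odd_rep:
  assumes "odd (snd x)"
  shows "nf_conj m x (fst x mod 2, 1) \<or> nf_conj m x (fst x mod 2, 3)"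
proof -
  obtain i j where x: "x = (i, j)" by (cases x)
  \<comment> \<open>Chosen so that \<open>i + 2 * p\<close> equals \<open>i mod 2\<close>.\<close>
  define p where "p = - (i div 2)"
  have i: "i = i mod 2 - 2 * p" by (simp add: p_def minus_mod_eq_mult_div)
  have "parity_sign p * j mod 4 = 1 \<or> parity_sign p * j mod 4 = 3"
    using assms unfolding x parity_sign_def by (simp split: if_splits) presburger
  moreover have "nf_conj m x (i mod 2, l)" if "parity_sign p * j mod 4 = l" "odd l" for l
  proof -
    have "[parity_sign p * l = j] (mod 4)"
      using that by (auto simp: cong_def parity_sign_def mod_minus_eq)
    moreover have "i mod 2 - p = p + i" using i by linarith
    ultimately have "nf_cong m (nf_mult (i mod 2, l) (p, 0)) (nf_mult (p, 0) x)"
      using \<open>odd l\<close> by (simp add: x nf_cong_def parity_sign_def[of l])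
    then show ?thesis unfolding nf_conj_def by blast
  qed
  ultimately show ?thesis by (auto simp: x)
qed

text \<open>Left to right, \<open>nf_part\<close> is constant on classes and agrees on commuting
  noncentral elements. Conversely, elements with even second exponents commute outright, and for odd
  ones suitable representatives commute.\<close>

lemma cls_commute_iff:
  assumes x: "\<not> nf_central m x" and y: "\<not> nf_central m y"
  shows "(\<exists>g\<in>cls m x. \<exists>h\<in>cls m y. g \<otimes>\<^bsub>V8m m\<^esub> h = h \<otimes>\<^bsub>V8m m\<^esub> g) \<longleftrightarrow> nf_part x = nf_part y"
    (is "?L \<longleftrightarrow> ?R")
proof -
  have L: "?L \<longleftrightarrow> (\<exists>x' y'. nf_conj m x x' \<and> nf_conj m y y' \<and> nf_cong m (nf_mult x' y') (nf_mult y' x'))"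
    unfolding cls_eq_image by (auto simp: elt_mult elt_eq_iff)
  show ?thesis
  proof
    assume ?L
    then obtain x' y' where "nf_conj m x x'" "nf_conj m y y'" "nf_cong m (nf_mult x' y') (nf_mult y' x')"
      unfolding L by blast
    then show ?R
      using x y by (metis nf_part_conj nf_central_conj nf_commute_imp_part_eq)
  next
    assume part: ?R
    show ?L
    proof (cases "even (snd x)")
      case True
      then have "even (snd y)" using part by (auto simp: nf_part_def split: if_splits)
      with True have "nf_cong m (nf_mult x y) (nf_mult y x)"
        by (cases x; cases y) (auto simp: nf_cong_def cong_4_iff parity_sign_def add.commute elim!: evenE)
      moreover have "nf_conj m x x" "nf_conj m y y" by (simp_all flip: cls_eq_iff)
      ultimately show ?thesis unfolding L by blast
    next
      case False
      then have "odd (snd y)" and "fst x mod 2 = fst y mod 2"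
        using part by (auto simp: nf_part_def odd_iff_mod_2_eq_one split: if_splits)
      then have "\<exists>j\<in>{1, 3}. \<exists>l\<in>{1, 3}. nf_conj m x (fst x mod 2, j) \<and> nf_conj m y (fst x mod 2, l)"
        using nf_conj_odd_rep[of x m] nf_conj_odd_rep[of y m] False by auto
      then obtain j l where "j \<in> {1, 3}" "l \<in> {1, 3}"
        "nf_conj m x (fst x mod 2, j)" "nf_conj m y (fst x mod 2, l)" by blast
      \<comment> \<open>The representatives share their first exponent, so the first coordinates of
        the two products coincide; the second ones differ by 0 or by \<open>2 (l - j)\<close>, a
        multiple of 4 because \<open>j\<close> and \<open>l\<close> are odd.\<close>
      moreover from this have "nf_cong m (nf_mult (fst x mod 2, j) (fst x mod 2, l)) (nf_mult (fst x mod 2, l) (fst x mod 2, j))"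
        by (auto simp: nf_cong_def cong_4_iff parity_sign_def)
      ultimately show ?thesis unfolding L by blast
    qed
  qed
qed

text \<open>Elements with even second exponent commute with one another, so only the parity of the
  exponent of \<open>b\<close> in the conjugator matters. The second alternative is conjugation by
  \<open>b\<close>, so a class has at most two elements.\<close>

lemma nf_conj_even_iff:
  assumes "even j"
  shows "nf_conj m (i, j) (k, l) \<longleftrightarrow>
    [k = i] (mod 2 * int m) \<and> [l = j] (mod 4) \<or>
    [k = - i] (mod 2 * int m) \<and> [l = parity_sign i - 1 + j] (mod 4)" (is "?L \<longleftrightarrow> ?R")
proof
  assume ?L
  then obtain p q where fst: "[k + parity_sign l * p = p + parity_sign q * i] (mod 2 * int m)"
    and snd: "[parity_sign p * l + q = parity_sign i * q + j] (mod 4)"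
    unfolding nf_conj_def nf_cong_def by auto
  have "even l" using nf_conj_parity(2)[OF \<open>?L\<close>] assms by simp
  then have "[k = parity_sign q * i] (mod 2 * int m)"
    using fst by (simp add: parity_sign_def[of l] cong_iff_dvd_diff)
  moreover have "[l = (if even q then j else parity_sign i - 1 + j)] (mod 4)"
    using snd \<open>even l\<close> assms unfolding cong_4_iff parity_sign_def
    by (simp split: if_splits) presburger+
  ultimately show ?R by (auto simp: parity_sign_def[of q] split: if_splits)
next
  assume ?R
  then show ?L
  proof
    assume *: "[k = i] (mod 2 * int m) \<and> [l = j] (mod 4)"
    then have "nf_cong m (nf_mult (k, l) (0, 0)) (nf_mult (0, 0) (i, j))"
      by (simp add: nf_cong_def)
    then show ?thesis unfolding nf_conj_def by blast
  next
    assume *: "[k = - i] (mod 2 * int m) \<and> [l = parity_sign i - 1 + j] (mod 4)"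
    then have "[l + 1 = parity_sign i - 1 + j + 1] (mod 4)"
      by (simp only: cong_add_rcancel)
    with * have "nf_cong m (nf_mult (k, l) (0, 1)) (nf_mult (0, 1) (i, j))"
      by (simp add: nf_cong_def)
    then show ?thesis unfolding nf_conj_def by blast
  qed
qed

section \<open>Counting the classes in each part\<close>

definition part_classes :: "nat \<Rightarrow> nat \<Rightarrow> generator word set set set" where
  "part_classes m t = cls m ` {x. \<not> nf_central m x \<and> nf_part x = t}"

text \<open>For odd \<open>m\<close>, conjugation by \<open>a^m\<close> shifts the first exponent by
  \<open>2m\<close> and negates the second, turning 1 into 3. Conversely, any conjugator yields an
  odd multiple of \<open>m\<close>.\<close>

lemma nf_conj_odd_pair_iff:
  assumes "p \<in> {0, 1}"
  shows "nf_conj m (p, 1) (p, 3) \<longleftrightarrow> odd m"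
proof
  assume "nf_conj m (p, 1) (p, 3)"
  then obtain u v where fst: "[p - u = u + parity_sign v * p] (mod 2 * int m)"
    and snd: "[parity_sign u * 3 + v = parity_sign p * v + 1] (mod 4)"
    unfolding nf_conj_def nf_cong_def by (auto simp: parity_sign_def[of 3])
  have *: "2 * int m dvd 2 * z \<Longrightarrow> odd z \<Longrightarrow> odd m" for z
    by simp (metis dvd_trans even_of_nat)
  show "odd m"
  \<comment> \<open>The first coordinates give \<open>2 (1 - u) = 0\<close> modulo \<open>2m\<close>
    in this case and \<open>2 u = 0\<close> otherwise; the second ones make \<open>1 - u\<close>,
    respectively \<open>u\<close>, odd.\<close>
  proof (cases "p = 1 \<and> odd v")
    case True
    then have "2 * int m dvd 2 * (1 - u)"
      using fst by (simp add: cong_iff_dvd_diff parity_sign_def)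
    moreover have "even u"
      using snd True unfolding cong_4_iff parity_sign_def by (simp split: if_splits) presburger
    ultimately show ?thesis using * by fastforce
  next
    case False
    then have "2 * int m dvd 2 * u"
      using fst assms dvd_minus_iff[of "2 * int m" "2 * u"]
      by (auto simp: cong_iff_dvd_diff parity_sign_def)
    moreover have "odd u"
    proof -
      consider "p = 0" | "p = 1" "even v" using False assms by blast
      then show ?thesis
        using snd unfolding cong_4_iff parity_sign_def
        by cases (auto split: if_splits; presburger)+
    qed
    ultimately show ?thesis using * by blast
  qed
next
  assume "odd m"
  then have "nf_cong m (nf_mult (p, 3) (int m, 0)) (nf_mult (int m, 0) (p, 1))"
    by (simp add: nf_cong_def parity_sign_def cong_iff_dvd_diff)
  then show "nf_conj m (p, 1) (p, 3)" unfolding nf_conj_def by blast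
qed

lemma card_part_classes_odd:
  assumes "p \<in> {0, 1}"
  shows "card (part_classes m (nat p + 1)) = (if even m then 2 else 1)"
proof -
  have "part_classes m (nat p + 1) = cls m ` {(p, 1), (p, 3)}" (is "?L = ?R")
  proof
    show "?L \<subseteq> ?R"
    proof
      fix X assume "X \<in> ?L"
      then obtain x where X: "X = cls m x" and "nf_part x = nat p + 1"
        by (auto simp: part_classes_def)
      then have "odd (snd x)" "fst x mod 2 = p"
        using assms by (auto simp: nf_part_def odd_iff_mod_2_eq_one split: if_splits)
      then show "X \<in> ?R"
        using nf_conj_odd_rep[of x m] by (auto simp: X simp flip: cls_eq_iff)
    qed
    show "?R \<subseteq> ?L"
      using assms by (auto simp: part_classes_def nf_central_def nf_part_def)
  qed
  then show ?thesis
    using nf_conj_odd_pair_iff[OF assms] by (simp add: cls_eq_iff card_insert_if)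
qed

text \<open>One pair per noncentral class with even second exponent. For even \<open>i\<close> the
  class joins \<open>i\<close> and \<open>-i\<close> with the same \<open>j\<close>, so
  \<open>i\<close> is taken below \<open>m\<close>; the values 0 and \<open>m\<close> would be
  central. For odd \<open>i\<close> it joins \<open>(i, j)\<close> and \<open>(-i, j - 2)\<close>,
  so the member with second exponent 0 is taken.\<close>

definition even_reps :: "nat \<Rightarrow> (int \<times> int) set" where
  "even_reps m = {i. even i \<and> 0 < i \<and> i < int m} \<times> {0, 2} \<union> {i. odd i \<and> 0 < i \<and> i < 2 * int m} \<times> {0}"

text \<open>The rounded quotient treats both parities at once: the value is \<open>2m - 2\<close>
  for even \<open>m \<ge> 2\<close> and \<open>2m - 1\<close> for odd \<open>m\<close>.\<close>

lemma card_even_reps: "card (even_reps m) = 2 * ((m - 1) div 2) + m"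
proof -
  have "{i. even i \<and> 0 < i \<and> i < int m} = (\<lambda>t. 2 * int t + 2) ` {..<(m - 1) div 2}"
  proof (intro equalityI subsetI)
    fix i assume "i \<in> {i. even i \<and> 0 < i \<and> i < int m}"
    then have "i = 2 * int (nat (i div 2 - 1)) + 2" "nat (i div 2 - 1) < (m - 1) div 2" by auto
    then show "i \<in> (\<lambda>t. 2 * int t + 2) ` {..<(m - 1) div 2}" by blast
  qed auto
  then have 1: "card {i. even i \<and> 0 < i \<and> i < int m} = (m - 1) div 2" "finite {i. even i \<and> 0 < i \<and> i < int m}"
    by (simp_all add: card_image inj_on_def)
  have "{i. odd i \<and> 0 < i \<and> i < 2 * int m} = (\<lambda>t. 2 * int t + 1) ` {..<m}"
  proof (intro equalityI subsetI)
    fix i assume "i \<in> {i. odd i \<and> 0 < i \<and> i < 2 * int m}"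
    then have "i = 2 * int (nat (i div 2)) + 1" "nat (i div 2) < m" by auto
    then show "i \<in> (\<lambda>t. 2 * int t + 1) ` {..<m}" by blast
  qed auto
  then have 2: "card {i. odd i \<and> 0 < i \<and> i < 2 * int m} = m" "finite {i. odd i \<and> 0 < i \<and> i < 2 * int m}"
    by (simp_all add: card_image inj_on_def)
  show ?thesis
    unfolding even_reps_def using 1 2
    by (subst card_Un_disjoint) (auto simp: card_cartesian_product)
qed

lemma part_classes_0:
  assumes "m \<ge> 1"
  shows "part_classes m 0 = cls m ` even_reps m"
proof
  have "\<not> nf_central m x \<and> nf_part x = 0" if "x \<in> even_reps m" for x
    using that by (auto simp: even_reps_def nf_central_def nf_part_def dest: zdvd_imp_le)
  then show "cls m ` even_reps m \<subseteq> part_classes m 0"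
    by (auto simp: part_classes_def)
next
  show "part_classes m 0 \<subseteq> cls m ` even_reps m"
  proof
    fix X assume "X \<in> part_classes m 0"
    then obtain i j where X: "X = cls m (i, j)" and nc: "\<not> nf_central m (i, j)" and j: "even j"
      by (auto simp: part_classes_def nf_part_def split: if_splits)
    have red: "[(z mod (2 * int m)) = z] (mod 2 * int m)" "0 \<le> z mod (2 * int m)"
      "z mod (2 * int m) < 2 * int m" "even (z mod (2 * int m)) \<longleftrightarrow> even z" for z
      using assms by (simp_all add: cong_imp_even_iff[of _ _ "int m"])
    have j4: "j mod 4 = 0 \<or> j mod 4 = 2" using j by presburger
    show "X \<in> cls m ` even_reps m"
    proof (cases "even i")
      case False
      \<comment> \<open>If \<open>j\<close> is 2 modulo 4, conjugation by \<open>b\<close> negates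
        \<open>i\<close> and brings the second exponent to 0.\<close>
      define k where "k = (if j mod 4 = 0 then i else - i) mod (2 * int m)"
      have "odd k" using False red(4) by (simp add: k_def)
      moreover have "0 \<le> k" "k < 2 * int m" unfolding k_def using red(2,3) by auto
      moreover from \<open>odd k\<close> have "k \<noteq> 0" by auto
      ultimately have "(k, 0) \<in> even_reps m" by (auto simp: even_reps_def)
      moreover have "nf_conj m (i, j) (k, 0)"
      proof (cases "j mod 4 = 0")
        case True
        then show ?thesis
          unfolding nf_conj_even_iff[OF j] by (simp add: k_def red(1)) (simp add: cong_def)
      next
        case neq: False
        with j4 have "[0 = parity_sign i - 1 + j] (mod 4)"
          using False unfolding cong_4_iff parity_sign_def by simp presburger
        with neq show ?thesis
          unfolding nf_conj_even_iff[OF j] by (simp add: k_def red(1))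
      qed
      ultimately show ?thesis by (auto simp: X simp flip: cls_eq_iff)
    next
      case True
      define r where "r = i mod (2 * int m)"
      \<comment> \<open>The residue is folded into the lower half by \<open>i \<mapsto> -i\<close>;
        noncentrality excludes the fixed points 0 and \<open>m\<close>.\<close>
      define k where "k = (if r < int m then r else 2 * int m - r)"
      have r: "even r" "0 \<le> r" "r < 2 * int m" "[r = i] (mod 2 * int m)"
        using True red by (simp_all add: r_def)
      have "\<not> int m dvd i" using nc True j by (simp add: nf_central_def)
      then have "\<not> int m dvd r" by (simp add: r_def dvd_mod_iff)
      then have "r \<noteq> 0" "r \<noteq> int m" by auto
      with r have "(k, j mod 4) \<in> even_reps m"
        using j4 by (auto simp: k_def even_reps_def)
      moreover have "[k = i] (mod 2 * int m) \<or> [k = - i] (mod 2 * int m)"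
      proof -
        have "[2 * int m - r = - r] (mod 2 * int m)" by (simp add: cong_iff_dvd_diff)
        then show ?thesis
          using r(4) cong_minus_minus_iff[of r i "2 * int m"] by (auto simp: k_def intro: cong_trans)
      qed
      then have "nf_conj m (i, j) (k, j mod 4)"
        unfolding nf_conj_even_iff[OF j] using True by (simp add: parity_sign_def)
      ultimately show ?thesis by (auto simp: X simp flip: cls_eq_iff)
    qed
  qed
qed

lemma card_part_classes_0:
  assumes "m \<ge> 1"
  shows "card (part_classes m 0) = 2 * ((m - 1) div 2) + m"
proof -
  have "inj_on (cls m) (even_reps m)"
  proof (rule inj_onI)
    fix x y assume x: "x \<in> even_reps m" and y: "y \<in> even_reps m" and "cls m x = cls m y"
    then have conj: "nf_conj m x y" by (simp add: cls_eq_iff)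
    obtain i j k l where eqs: "x = (i, j)" "y = (k, l)" by (metis surj_pair)
    have bds: "0 < i" "i < 2 * int m" "0 < k" "k < 2 * int m" "even j" "even i = even k"
      and jl: "j \<in> {0, 2}" "l \<in> {0, 2}" "odd i \<Longrightarrow> j = 0" "odd k \<Longrightarrow> l = 0"
      and lt: "even i \<Longrightarrow> i < int m" "even k \<Longrightarrow> k < int m"
      using x y nf_conj_parity(1)[OF conj] by (auto simp: eqs even_reps_def)
    from conj consider "[k = i] (mod 2 * int m)" "[l = j] (mod 4)"
      | "[k = - i] (mod 2 * int m)" "[l = parity_sign i - 1 + j] (mod 4)"
      unfolding eqs nf_conj_even_iff[OF bds(5)] by blast
    then show "x = y"
    proof cases
      case 1
      then have "k = i" using bds cong_less_imp_eq_int[of k "2 * int m" i] by simp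
      moreover have "l = j" using 1(2) jl by (auto simp: cong_def)
      ultimately show ?thesis by (simp add: eqs)
    next
      case 2
      show ?thesis
      \<comment> \<open>For even \<open>i\<close> the sum \<open>k + i\<close> would be a multiple
        of \<open>2m\<close> strictly between 0 and \<open>2m\<close>. For odd \<open>i\<close> the
        second exponents would differ by 2 although both are 0.\<close>
      proof (cases "even i")
        case True
        then have "k + i < 2 * int m" using lt bds by simp
        moreover have "2 * int m dvd k + i" using 2(1) by (simp add: cong_iff_dvd_diff)
        ultimately show ?thesis using bds zdvd_not_zless[of "k + i" "2 * int m"] by simp
      next
        case False
        then show ?thesis using 2(2) jl bds by (auto simp: cong_def parity_sign_def)
      qed
    qed
  qed
  then show ?thesis by (simp add: part_classes_0[OF assms] card_image card_even_reps)
qed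

section \<open>Disjoint unions of complete graphs\<close>

definition clique_union :: "'v set set \<Rightarrow> 'v sgraph" where
  "clique_union F = (\<Union>F, \<Union>C\<in>F. {e. e \<subseteq> C \<and> card e = 2})"

lemma degree_clique_union:
  assumes F: "pairwise disjnt F" and C: "C \<in> F" "finite C" and v: "v \<in> C"
  shows "degree (clique_union F) v = card C - 1"
proof -
  have "{e \<in> edges (clique_union F). v \<in> e} = (\<lambda>w. {v, w}) ` (C - {v})"
  proof (intro equalityI subsetI)
    fix e assume "e \<in> {e \<in> edges (clique_union F). v \<in> e}"
    then obtain D where D: "D \<in> F" "e \<subseteq> D" "card e = 2" "v \<in> e"
      by (auto simp: clique_union_def)
    then have "D = C" using F C v by (auto simp: pairwise_def disjnt_iff)
    moreover obtain w where "e = {v, w}" "w \<noteq> v"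
      using D by (auto simp: card_2_iff)
    ultimately show "e \<in> (\<lambda>w. {v, w}) ` (C - {v})" using D by auto
  qed (use C v in \<open>auto simp: clique_union_def card_2_iff\<close>)
  moreover have "inj_on (\<lambda>w. {v, w}) (C - {v})"
    by (auto simp: inj_on_def doubleton_eq_iff)
  ultimately show ?thesis
    using C v by (simp add: degree_def card_image)
qed

context
  fixes F :: "'v set set"
  assumes finite_F: "finite F" and finite_members: "\<And>C. C \<in> F \<Longrightarrow> finite C"
    and disjoint_F: "pairwise disjnt F"
begin

lemma card_verts_clique_union: "card (verts (clique_union F)) = (\<Sum>C\<in>F. card C)"
  by (simp add: clique_union_def card_Union_disjoint disjoint_F finite_members)

lemma zagreb1_clique_union: "zagreb1 (clique_union F) = (\<Sum>C\<in>F. card C * (card C - 1)\<^sup>2)"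
proof -
  have "zagreb1 (clique_union F) = (\<Sum>v\<in>\<Union>F. (degree (clique_union F) v)\<^sup>2)"
    by (simp add: zagreb1_def) (simp add: clique_union_def)
  also have "\<dots> = (\<Sum>C\<in>F. \<Sum>v\<in>C. (degree (clique_union F) v)\<^sup>2)"
    using disjoint_F finite_members
    by (subst sum.Union_disjoint) (auto simp: pairwise_def disjnt_def)
  also have "\<dots> = (\<Sum>C\<in>F. card C * (card C - 1)\<^sup>2)"
    by (simp add: degree_clique_union disjoint_F finite_members)
  finally show ?thesis .
qed

text \<open>An edge is nonempty and lies inside one member, so distinct members share no edge. With
  different \<open>f\<close> this serves both the edge count and the second Zagreb index.\<close>

lemma sum_edges_clique_union:
  "(\<Sum>e\<in>edges (clique_union F). f e) = (\<Sum>C\<in>F. \<Sum>e | e \<subseteq> C \<and> card e = 2. f e)"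
proof -
  have "{e. e \<subseteq> C \<and> card e = 2} \<inter> {e. e \<subseteq> D \<and> card e = 2} = {}"
    if "C \<in> F" "D \<in> F" "C \<noteq> D" for C D
    using disjoint_F that by (fastforce simp: pairwise_def disjnt_iff card_2_iff)
  moreover have "finite {e. e \<subseteq> C \<and> card e = 2}" if "C \<in> F" for C
    using finite_members[OF that] by simp
  ultimately show ?thesis
    by (simp add: clique_union_def sum.UNION_disjoint finite_F)
qed

lemma card_edges_clique_union: "card (edges (clique_union F)) = (\<Sum>C\<in>F. card C choose 2)"
  using sum_edges_clique_union[of "\<lambda>_. 1 :: nat"] by (simp add: n_subsets finite_members)

lemma zagreb2_clique_union:
  "zagreb2 (clique_union F) = (\<Sum>C\<in>F. (card C choose 2) * (card C - 1)\<^sup>2)"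
proof -
  have "(\<Prod>v\<in>e. degree (clique_union F) v) = (card C - 1)\<^sup>2"
    if "C \<in> F" "e \<subseteq> C" "card e = 2" for C e
  proof -
    have "(\<Prod>v\<in>e. degree (clique_union F) v) = (\<Prod>v\<in>e. card C - 1)"
      using that finite_members degree_clique_union[OF disjoint_F] by (intro prod.cong) auto
    then show ?thesis using that by simp
  qed
  then have "zagreb2 (clique_union F) = (\<Sum>C\<in>F. \<Sum>e | e \<subseteq> C \<and> card e = 2. (card C - 1)\<^sup>2)"
    by (simp add: zagreb2_def sum_edges_clique_union)
  also have "\<dots> = (\<Sum>C\<in>F. (card C choose 2) * (card C - 1)\<^sup>2)"
    by (simp add: n_subsets finite_members)
  finally show ?thesis .
qed

end

section \<open>The graph of \<open>V8m m\<close> as three cliques\<close>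

lemma CCC_V8m: "CCC (V8m m) = clique_union (part_classes m ` {..<3})"
proof -
  have "nf_part x < 3" for x by (simp add: nf_part_def)
  then have verts: "noncentral_classes (V8m m) = \<Union> (part_classes m ` {..<3})"
    by (fastforce simp: noncentral_classes_V8m part_classes_def)
  have adj: "(\<exists>g\<in>X. \<exists>h\<in>Y. g \<otimes>\<^bsub>V8m m\<^esub> h = h \<otimes>\<^bsub>V8m m\<^esub> g) \<longleftrightarrow>
    (\<exists>t<3. X \<in> part_classes m t \<and> Y \<in> part_classes m t)"
    if XY: "X \<in> noncentral_classes (V8m m)" "Y \<in> noncentral_classes (V8m m)" for X Y
  proof -
    obtain x y where xy: "X = cls m x" "Y = cls m y" "\<not> nf_central m x" "\<not> nf_central m y"
      using XY by (auto simp: noncentral_classes_V8m)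
    \<comment> \<open>Since \<open>nf_part\<close> is constant on classes, each noncentral class
      lies in exactly one part.\<close>
    have "cls m z \<in> part_classes m t \<longleftrightarrow> nf_part z = t" if "\<not> nf_central m z" for z t
      using that nf_part_conj[of m z] by (auto simp: part_classes_def cls_eq_iff)
    then show ?thesis
      using xy \<open>nf_part x < 3\<close> by (auto simp: cls_commute_iff)
  qed
  have "edges (CCC (V8m m)) = (\<Union>t<3. {e. e \<subseteq> part_classes m t \<and> card e = 2})"
    unfolding CCC_def snd_conv
  proof (intro equalityI subsetI)
    fix e assume "e \<in> {{X, Y} | X Y. X \<in> noncentral_classes (V8m m) \<and> Y \<in> noncentral_classes (V8m m) \<and>
      X \<noteq> Y \<and> (\<exists>g\<in>X. \<exists>h\<in>Y. g \<otimes>\<^bsub>V8m m\<^esub> h = h \<otimes>\<^bsub>V8m m\<^esub> g)}"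
    then obtain X Y where e: "e = {X, Y}" "X \<noteq> Y" and
      "X \<in> noncentral_classes (V8m m)" "Y \<in> noncentral_classes (V8m m)"
      "\<exists>g\<in>X. \<exists>h\<in>Y. g \<otimes>\<^bsub>V8m m\<^esub> h = h \<otimes>\<^bsub>V8m m\<^esub> g"
      by blast
    then obtain t where "t < 3" "X \<in> part_classes m t" "Y \<in> part_classes m t"
      using adj by blast
    moreover have "card e = 2" using e by (simp add: card_insert_if)
    ultimately show "e \<in> (\<Union>t<3. {e. e \<subseteq> part_classes m t \<and> card e = 2})"
      using e by auto
  next
    fix e assume "e \<in> (\<Union>t<3. {e. e \<subseteq> part_classes m t \<and> card e = 2})"
    then obtain t X Y where *: "t < 3" "X \<in> part_classes m t" "Y \<in> part_classes m t" "e = {X, Y}" "X \<noteq> Y"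
      by (auto simp: card_2_iff)
    then have "X \<in> noncentral_classes (V8m m)" "Y \<in> noncentral_classes (V8m m)"
      unfolding verts by auto
    with * adj[OF this] show "e \<in> {{X, Y} | X Y. X \<in> noncentral_classes (V8m m) \<and> Y \<in> noncentral_classes (V8m m) \<and>
      X \<noteq> Y \<and> (\<exists>g\<in>X. \<exists>h\<in>Y. g \<otimes>\<^bsub>V8m m\<^esub> h = h \<otimes>\<^bsub>V8m m\<^esub> g)}"
      by blast
  qed
  then show ?thesis
    by (intro prod_eqI) (simp_all add: clique_union_def CCC_def verts)
qed

lemma CCC_V8m_cliques:
  assumes "m \<ge> 1"
  obtains K P Q where "CCC (V8m m) = clique_union {K, P, Q}" "finite K" "finite P" "finite Q"
    "disjnt K P" "disjnt K Q" "disjnt P Q"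
    "card K = 2 * ((m - 1) div 2) + m" "card P = (if even m then 2 else 1)"
    "card Q = (if even m then 2 else 1)"
proof
  have "{..<3} = {0, 1, 2 :: nat}" by auto
  then show "CCC (V8m m) = clique_union {part_classes m 0, part_classes m 1, part_classes m 2}"
    by (simp add: CCC_V8m)
  show c0: "card (part_classes m 0) = 2 * ((m - 1) div 2) + m"
    by (rule card_part_classes_0[OF assms])
  show c1: "card (part_classes m 1) = (if even m then 2 else 1)"
    and c2: "card (part_classes m 2) = (if even m then 2 else 1)"
    using card_part_classes_odd[of 0 m] card_part_classes_odd[of 1 m] by (simp_all add: numeral_2_eq_2)
  show "finite (part_classes m 0)" "finite (part_classes m 1)" "finite (part_classes m 2)"
    using c0 c1 c2 assms by (auto intro!: card_ge_0_finite)
  have "disjnt (part_classes m s) (part_classes m t)" if "s \<noteq> t" for s t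
    using that nf_part_conj by (auto simp: disjnt_iff part_classes_def cls_eq_iff)
  then show "disjnt (part_classes m 0) (part_classes m 1)" "disjnt (part_classes m 0) (part_classes m 2)"
    "disjnt (part_classes m 1) (part_classes m 2)" by simp_all
qed

lemma CCC_V8m_sums:
  assumes "m \<ge> 1"
  defines "k \<equiv> 2 * ((m - 1) div 2) + m" and "l \<equiv> if even m then 2 else 1"
  shows "card (verts (CCC (V8m m))) = k + 2 * l"
    "card (edges (CCC (V8m m))) = (k choose 2) + 2 * (l choose 2)"
    "zagreb1 (CCC (V8m m)) = k * (k - 1)\<^sup>2 + 2 * (l * (l - 1)\<^sup>2)"
    "zagreb2 (CCC (V8m m)) = (k choose 2) * (k - 1)\<^sup>2 + 2 * ((l choose 2) * (l - 1)\<^sup>2)"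
proof -
  obtain K P Q where KPQ: "CCC (V8m m) = clique_union {K, P, Q}" "finite K" "finite P" "finite Q"
    "disjnt K P" "disjnt K Q" "disjnt P Q" "card K = k" "card P = l" "card Q = l"
    unfolding k_def l_def by (rule CCC_V8m_cliques[OF assms(1)])
  have disj: "pairwise disjnt {K, P, Q}"
    using KPQ by (auto simp: pairwise_insert disjnt_sym)
  have "k > 0" "l > 0" using assms(1) by (auto simp: k_def l_def)
  \<comment> \<open>Disjoint nonempty sets are distinct, so a sum over \<open>{K, P, Q}\<close>
    really has three summands, even when \<open>P\<close> and \<open>Q\<close> have equal
    size.\<close>
  then have "K \<noteq> P" "K \<noteq> Q" "P \<noteq> Q" using KPQ by (auto simp: disjnt_def)
  moreover have fin: "finite C" if "C \<in> {K, P, Q}" for C using that KPQ by auto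
  have "finite {K, P, Q}" by simp
  note sums = card_verts_clique_union[OF this fin disj] card_edges_clique_union[OF this fin disj]
    zagreb1_clique_union[OF this fin disj] zagreb2_clique_union[OF this fin disj]
  ultimately show "card (verts (CCC (V8m m))) = k + 2 * l"
    "card (edges (CCC (V8m m))) = (k choose 2) + 2 * (l choose 2)"
    "zagreb1 (CCC (V8m m)) = k * (k - 1)\<^sup>2 + 2 * (l * (l - 1)\<^sup>2)"
    "zagreb2 (CCC (V8m m)) = (k choose 2) * (k - 1)\<^sup>2 + 2 * ((l choose 2) * (l - 1)\<^sup>2)"
    using KPQ(8-10) by (simp_all add: KPQ(1) sums)
qed

section \<open>Zagreb indices and comparison of the averages\<close>

theorem theorem2p5:
  fixes m :: nat
  assumes "m \<ge> 1"
  shows "let \<Gamma> = CCC (V8m m) in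
    real (zagreb1 \<Gamma>) =
      (if even m then (2 * real m - 2) * (2 * real m - 3) ^ 2 + 4
       else (2 * real m - 1) * (2 * real m - 2) ^ 2) \<and>
    real (zagreb2 \<Gamma>) =
      (if even m then (real m - 1) * (2 * real m - 3) ^ 3 + 2
       else (2 * real m - 1) * (2 * real m - 2) ^ 3 / 2) \<and>
    real (zagreb2 \<Gamma>) / real (card (edges \<Gamma>))
      \<ge> real (zagreb1 \<Gamma>) / real (card (verts \<Gamma>)) \<and>
    (real (zagreb2 \<Gamma>) / real (card (edges \<Gamma>))
      = real (zagreb1 \<Gamma>) / real (card (verts \<Gamma>)) \<longleftrightarrow> m = 1 \<or> m = 2)"
proof (cases "even m")
  case True
  then obtain r where "m = 2 * r" by blast
  with assms have "m = 2 * (r - 1) + 2" by simp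
  then obtain q where m: "m = 2 * q + 2" by blast
  have choose: "(4 * q + 2) choose 2 = (2 * q + 1) * (4 * q + 1)"
    by (simp add: choose_two)
  have k: "2 * ((m - 1) div 2) + m = 4 * q + 2" by (simp add: m)
  \<comment> \<open>This is \<open>2m - 3\<close>, the degree in the large clique of
    \<open>2m - 2\<close> vertices; the two small cliques are single edges.\<close>
  define x where "x = 4 * real q + 1"
  have x: "x \<ge> 1" "2 * real m - 2 = x + 1" "2 * real m - 3 = x" "real m - 1 = (x + 1) / 2"
    "x = 1 \<longleftrightarrow> m = 2"
    by (auto simp: x_def m)
  note sums = CCC_V8m_sums[OF assms, unfolded k choose if_P[OF True]]
  have v: "real (card (verts (CCC (V8m m)))) = x + 5"
    unfolding sums by (simp add: x_def)
  have e: "real (card (edges (CCC (V8m m)))) = (x + 1) / 2 * x + 2"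
    unfolding sums by (simp add: x_def algebra_simps)
  have z1: "real (zagreb1 (CCC (V8m m))) = (x + 1) * x\<^sup>2 + 4"
    unfolding sums by (simp add: x_def algebra_simps)
  have z2: "real (zagreb2 (CCC (V8m m))) = (x + 1) / 2 * x ^ 3 + 2"
    unfolding sums by (simp add: x_def power2_eq_square power3_eq_cube field_simps)
  define V E M1 M2 where "V = x + 5" and "E = (x + 1) / 2 * x + 2"
    and "M1 = (x + 1) * x\<^sup>2 + 4" and "M2 = (x + 1) / 2 * x ^ 3 + 2"
  have pos: "V > 0" "E > 0" using x(1) by (simp_all add: V_def E_def add_nonneg_pos)
  \<comment> \<open>The difference of the averages, cleared of positive denominators, is twice a
    square; as \<open>x \<ge> 1\<close>, it vanishes only at \<open>x = 1\<close>, that is for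
    \<open>m = 2\<close>.\<close>
  have diff: "M2 * V - M1 * E = 2 * ((x + 1) * (x - 1))\<^sup>2"
    by (simp add: V_def E_def M1_def M2_def field_simps power2_eq_square power3_eq_cube)
  have "M1 / V \<le> M2 / E \<longleftrightarrow> 0 \<le> M2 * V - M1 * E" and "M2 / E = M1 / V \<longleftrightarrow> M2 * V - M1 * E = 0"
    using pos by (simp_all add: field_simps)
  then have "M1 / V \<le> M2 / E" "M2 / E = M1 / V \<longleftrightarrow> m = 2"
    unfolding diff using x by auto
  moreover have "m \<noteq> 1" by (simp add: m)
  ultimately show ?thesis
    unfolding Let_def v e z1 z2 x(2-4) V_def E_def M1_def M2_def if_P[OF True] by simp
next
  case False
  then obtain q where m: "m = 2 * q + 1" by (auto elim: oddE)
  have k: "2 * ((m - 1) div 2) + m = 4 * q + 1" by (simp add: m)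
  have choose: "(4 * q + 1) choose 2 = (4 * q + 1) * (2 * q)"
    by (simp add: choose_two)
  \<comment> \<open>This is \<open>m - 1\<close>; the large clique has \<open>2 w + 1\<close>
    vertices of degree \<open>2 w\<close>, and the other two parts are isolated vertices.\<close>
  define w where "w = 2 * real q"
  have w: "w \<ge> 0" "2 * real m - 1 = 2 * w + 1" "2 * real m - 2 = 2 * w" "w = 0 \<longleftrightarrow> m = 1"
    by (auto simp: w_def m)
  note sums = CCC_V8m_sums[OF assms, unfolded k choose if_not_P[OF False]]
  have v: "real (card (verts (CCC (V8m m)))) = 2 * w + 3"
    unfolding sums by (simp add: w_def)
  have e: "real (card (edges (CCC (V8m m)))) = (2 * w + 1) * w"
    unfolding sums by (simp add: w_def binomial_eq_0 algebra_simps)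
  have z1: "real (zagreb1 (CCC (V8m m))) = (2 * w + 1) * (2 * w)\<^sup>2"
    unfolding sums by (simp add: w_def power2_eq_square algebra_simps)
  have z2: "real (zagreb2 (CCC (V8m m))) = (2 * w + 1) * (2 * w) ^ 3 / 2"
    unfolding sums by (simp add: w_def power2_eq_square power3_eq_cube binomial_eq_0 algebra_simps)
  \<comment> \<open>All edges lie in the large clique, so the right side is
    \<open>(2 * w)\<^sup>2\<close> exactly, whereas the isolated vertices pull the vertex average
    below that.\<close>
  have strict: "(2 * w + 1) * (2 * w)\<^sup>2 / (2 * w + 3) < (2 * w + 1) * (2 * w) ^ 3 / 2 / ((2 * w + 1) * w)"
    if "w \<noteq> 0"
  proof -
    have "w > 0" using w(1) that by simp
    then have "(2 * w + 1) * (2 * w) ^ 3 / 2 / ((2 * w + 1) * w) = (2 * w)\<^sup>2"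
      by (simp add: power2_eq_square power3_eq_cube)
    moreover have "(2 * w + 1) * (2 * w)\<^sup>2 / (2 * w + 3) < (2 * w)\<^sup>2"
      using \<open>w > 0\<close> by (simp add: field_simps)
    ultimately show ?thesis by simp
  qed
  have "m \<noteq> 2" using False by auto
  show ?thesis
  proof (cases "w = 0")
    case True
    \<comment> \<open>Here the graph has three vertices and no edges; \<open>0 / 0 = 0\<close> in
      the reals agrees with the convention for the quotient, and both sides are 0.\<close>
    then have "m = 1" using w(4) by blast
    with True show ?thesis
      unfolding Let_def v e z1 z2 w(2,3) if_not_P[OF False] by simp
  next
    case nonzero: False
    have "m \<noteq> 1" using w(4) nonzero by blast
    then show ?thesis
      unfolding Let_def v e z1 z2 w(2,3) if_not_P[OF False]
      using strict[OF nonzero] \<open>m \<noteq> 2\<close> by (intro conjI refl less_imp_le) auto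
  qed
qed

end
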